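(* Let $S$ be a positive semiring, and set $S^\bullet = S \setminus \{0\}$. Then $S$ is a bi-BFS provided that $1$ is not a limit point of $S^\bullet \setminus \{1\}$. In addition, for a real number $r > 0$, the positive semiring $S_r$ generated by the ray $\mathbb{R}_{\ge r}$ is a bi-BFS if and only if $r > 1$, in which case, \[ \mathcal{A}_+(S_r) = \big( \{1\} \cup [r,r+1) \big) \setminus \{ \lceil r \rceil \} \quad \text{ and } \quad \mathcal{A}_\times(S_r) = \big( \mathbb{P}_{< r^2} \cup [r,r^2) \big) \setminus \mathbb{P} \cdot (S_r)_{> 1}. \]
   Context: A positive semiring is a subset of $\mathbb{R}_{\ge 0}$ containing $0$ and $1$ and closed under the usual addition and multiplication; the positive semiring $S_r$ generated by $\mathbb{R}_{\ge r} = \{x \in \mathbb{R} \mid x \ge r\}$ is the smallest positive semiring containing $\mathbb{R}_{\ge r}$. For a positive semiring $S$, the additive monoid is $(S,+)$ and the multiplicative monoid is $(S \setminus \{0\}, \cdot)$. An atom of a (cancellative commutative) monoid is a non-invertible element that is not a product (sum, in additive notation) of two non-invertible elements; $\mathcal{A}_+(S)$ and $\mathcal{A}_\times(S)$ denote the sets of atoms of $(S,+)$ and $(S \setminus \{0\},\cdot)$, respectively. A monoid is atomic if every non-invertible element is a finite product (sum) of atoms. An atomic monoid is a bounded factorization monoid (BFM) if for every element $b$ the set of lengths $\ell$ of factorizations of $b$ into $\ell$ atoms (up to units) is finite. A positive semiring is a bi-BFS if both its additive and its multiplicative monoids are BFMs. $\mathbb{P}$ is the set of prime numbers, $\mathbb{P}_{<r^2}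 = \{p \in \mathbb{P} \mid p < r^2\}$, $(S_r)_{>1} = \{s \in S_r \mid s > 1\}$, and $\mathbb{P} \cdot (S_r)_{>1} = \{ps \mid p \in \mathbb{P},\ s \in (S_r)_{>1}\}$. *)

theory Defs
  imports
    "HOL-Analysis.Elementary_Topology"
    "HOL-Algebra.Divisibility"
    "HOL-Computational_Algebra.Primes"
begin

definition atoms :: "('a, 'b) monoid_scheme \<Rightarrow> 'a set" where
  "atoms G = {a \<in> carrier G - Units G.
     \<not> (\<exists>b \<in> carrier G - Units G. \<exists>c \<in> carrier G - Units G. a = b \<otimes>\<^bsub>G\<^esub> c)}"

definition atomic_monoid :: "('a, 'b) monoid_scheme \<Rightarrow> bool" where
  "atomic_monoid G \<longleftrightarrow> comm_monoid_cancel G \<and>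
     (\<forall>x \<in> carrier G - Units G. \<exists>as. set as \<subseteq> atoms G \<and> x = foldr (\<otimes>\<^bsub>G\<^esub>) as \<one>\<^bsub>G\<^esub>)"

definition lengths :: "('a, 'b) monoid_scheme \<Rightarrow> 'a \<Rightarrow> nat set" where
  "lengths G b = {length as | as u.
     set as \<subseteq> atoms G \<and> u \<in> Units G \<and> b = u \<otimes>\<^bsub>G\<^esub> foldr (\<otimes>\<^bsub>G\<^esub>) as \<one>\<^bsub>G\<^esub>}"

definition BFM :: "('a, 'b) monoid_scheme \<Rightarrow> bool" where
  "BFM G \<longleftrightarrow> atomic_monoid G \<and> (\<forall>b \<in> carrier G. finite (lengths G b))"

definition positive_semiring :: "real set \<Rightarrow> bool" where
  "positive_semiring S \<longleftrightarrow> S \<subseteq> {0..} \<and> 0 \<in> S \<and> 1 \<in> S \<and>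
     (\<forall>x \<in> S. \<forall>y \<in> S. x + y \<in> S \<and> x * y \<in> S)"

definition additive_monoid :: "real set \<Rightarrow> real monoid" where
  "additive_monoid S = \<lparr>carrier = S, mult = (+), one = 0\<rparr>"

definition multiplicative_monoid :: "real set \<Rightarrow> real monoid" where
  "multiplicative_monoid S = \<lparr>carrier = S - {0}, mult = (*), one = 1\<rparr>"

definition bi_BFS :: "real set \<Rightarrow> bool" where
  "bi_BFS S \<longleftrightarrow> positive_semiring S \<and> BFM (additive_monoid S) \<and> BFM (multiplicative_monoid S)"

abbreviation additive_atoms :: "real set \<Rightarrow> real set" where
  "additive_atoms S \<equiv> atoms (additive_monoid S)"

abbreviation multiplicative_atoms :: "real set \<Rightarrow> real set" where
  "multiplicative_atoms S \<equiv> atoms (multiplicative_monoid S)"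

definition ray_semiring :: "real \<Rightarrow> real set" where
  "ray_semiring r = positive_semiring hull {r..}"

definition real_primes :: "real set" where
  "real_primes = {real p | p :: nat. Factorial_Ring.prime p}"

text \<open>The two structures are monoids in the sense required by \<^const>\<open>atomic_monoid\<close>, and the hull
  defining \<^const>\<open>ray_semiring\<close> is attained.\<close>

lemma comm_monoid_cancel_additive_monoid:
  "positive_semiring S \<Longrightarrow> comm_monoid_cancel (additive_monoid S)"
  by (unfold_locales) (auto simp: positive_semiring_def additive_monoid_def)

lemma comm_monoid_cancel_multiplicative_monoid:
  "positive_semiring S \<Longrightarrow> comm_monoid_cancel (multiplicative_monoid S)"
  by (unfold_locales) (auto simp: positive_semiring_def multiplicative_monoid_def)

lemma positive_semiring_ray_semiring:
  assumes "r \<ge> 0"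
  shows "positive_semiring (ray_semiring r)"
proof -
  have "positive_semiring {0..}" by (auto simp: positive_semiring_def)
  moreover have "{r..} \<subseteq> {0..}" using assms by auto
  ultimately show ?thesis
    unfolding ray_semiring_def hull_def positive_semiring_def by blast
qed

lemma ray_subset_ray_semiring: "{r..} \<subseteq> ray_semiring r"
  unfolding ray_semiring_def by (rule hull_subset)

lemma ray_semiring_minimal:
  "positive_semiring T \<Longrightarrow> {r..} \<subseteq> T \<Longrightarrow> ray_semiring r \<subseteq> T"
  unfolding ray_semiring_def by (rule hull_minimal)

end

theory Submission imports Defs "HOL-Analysis.Elementary_Metric_Spaces"
begin

text \<open>A superadditive length function that is at least 1 on non-invertible elements makes a monoid
  a BFM. If 1 is isolated in \<open>S\<^sup>\<bullet>\<close>, then \<open>S\<close> has no element in (0,1), since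
  otherwise \<open>1 + x ^ n\<close> would accumulate at 1; hence the identity, respectively a scaled logarithm,
  is such a length function. For \<open>r > 1\<close> the ray semiring is the union of the natural numbers
  and the ray, from which the atoms are read off. Square roots for \<open>r = 1\<close> and halves
  for \<open>r < 1\<close> show that there are no multiplicative, respectively additive, atoms.\<close>

section \<open>Bounded factorization from length functions\<close>

text \<open>Splitting off a non-unit costs at least 1 in \<open>f\<close>, so repeated splitting
  ends in atoms. A product of \<open>n\<close> atoms has \<open>f\<close>-value at least
  \<open>n\<close>, which bounds the lengths.\<close>

lemma BFM_if_superadditive_length:
  fixes G (structure) and f :: "'a \<Rightarrow> real"
  assumes G: "comm_monoid_cancel G"
    and nonneg: "\<And>x. x \<in> carrier G \<Longrightarrow> 0 \<le> f x"
    and ge1: "\<And>x. x \<in> carrier G - Units G \<Longrightarrow> 1 \<le> f x"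
    and superadd: "\<And>x y. x \<in> carrier G \<Longrightarrow> y \<in> carrier G \<Longrightarrow> f x + f y \<le> f (x \<otimes> y)"
  shows "BFM G"
proof -
  interpret comm_monoid_cancel G by (rule G)
  have closed: "foldr (\<otimes>) as \<one> \<in> carrier G" if "set as \<subseteq> carrier G" for as
    using that by (induction as) auto
  have append: "foldr (\<otimes>) (as @ bs) \<one> = foldr (\<otimes>) as \<one> \<otimes> foldr (\<otimes>) bs \<one>"
    if "set as \<subseteq> carrier G" "set bs \<subseteq> carrier G" for as bs
    using that by (induction as) (auto simp: closed m_assoc simp del: foldr_append)
  have atoms_carrier: "atoms G \<subseteq> carrier G"
    by (auto simp: atoms_def)
  have "\<exists>as. set as \<subseteq> atoms G \<and> x = foldr (\<otimes>) as \<one>" if "x \<in> carrier G - Units G" for x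
    using that
  \<comment> \<open>The values of \<open>f\<close> are real, so the induction runs on their floors:
    a loss of at least 1 lowers the floor strictly.\<close>
  proof (induction "nat \<lfloor>f x\<rfloor>" arbitrary: x rule: less_induct)
    case less
    show ?case
    proof (cases "x \<in> atoms G")
      case True
      then show ?thesis
        using atoms_carrier by (intro exI[of _ "[x]"]) auto
    next
      case False
      then obtain b c where bc: "b \<in> carrier G - Units G" "c \<in> carrier G - Units G" "x = b \<otimes> c"
        using less.prems by (auto simp: atoms_def)
      have "f b + f c \<le> f x" "1 \<le> f b" "1 \<le> f c"
        using superadd[of b c] ge1 bc by auto
      then have "nat \<lfloor>f b\<rfloor> < nat \<lfloor>f x\<rfloor>" "nat \<lfloor>f c\<rfloor> < nat \<lfloor>f x\<rfloor>"
        by linarith+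
      then obtain as bs where "set as \<subseteq> atoms G" "b = foldr (\<otimes>) as \<one>"
          "set bs \<subseteq> atoms G" "c = foldr (\<otimes>) bs \<one>"
        using less.hyps bc by metis
      then show ?thesis
        using append[of as bs] atoms_carrier bc(3) by (intro exI[of _ "as @ bs"]) auto
    qed
  qed
  moreover have "finite (lengths G b)" if "b \<in> carrier G" for b
  proof (rule finite_subset)
    show "lengths G b \<subseteq> {..nat \<lfloor>f b\<rfloor>}"
    proof
      fix n assume "n \<in> lengths G b"
      then obtain as u where as: "set as \<subseteq> atoms G" "u \<in> Units G" "b = u \<otimes> foldr (\<otimes>) as \<one>"
        and n: "n = length as"
        by (auto simp: lengths_def)
      have "real (length as) \<le> f (foldr (\<otimes>) as \<one>)"
        using as(1)
      proof (induction as)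
        case Nil
        then show ?case using nonneg by simp
      next
        case (Cons a as)
        then have "a \<in> carrier G - Units G" "set as \<subseteq> carrier G"
          using atoms_carrier by (auto simp: atoms_def)
        then show ?case
          using Cons ge1[of a] superadd[of a "foldr (\<otimes>) as \<one>"] closed[of as] by simp
      qed
      \<comment> \<open>The unit contributes a nonnegative amount, so the bound for the atoms
        carries over to \<open>b\<close>.\<close>
      moreover have "f u + f (foldr (\<otimes>) as \<one>) \<le> f b" "0 \<le> f u"
        using as atoms_carrier nonneg superadd closed[of as] by auto
      ultimately have "real n \<le> f b" using n by simp
      then show "n \<in> {..nat \<lfloor>f b\<rfloor>}" by (simp add: le_nat_floor)
    qed
  qed simp
  ultimately show ?thesis
    using G by (auto simp: BFM_def atomic_monoid_def)
qed

text \<open>Without atoms only the empty product can be formed, and its value is the identity, so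
  the non-unit \<open>x\<close> has no factorization.\<close>

lemma not_BFM_if_no_atoms:
  fixes G (structure)
  assumes "x \<in> carrier G - Units G" and "atoms G = {}"
  shows "\<not> BFM G"
proof
  assume BFM: "BFM G"
  then interpret comm_monoid_cancel G by (simp add: BFM_def atomic_monoid_def)
  have "x = \<one>"
    using BFM assms by (fastforce simp: BFM_def atomic_monoid_def)
  then show False using assms(1) by simp
qed

section \<open>Non-units and atoms of the two monoids\<close>

lemma nonunits_additive_monoid:
  assumes "positive_semiring S"
  shows "carrier (additive_monoid S) - Units (additive_monoid S) = S - {0}"
proof -
  have "x = 0" if "x \<in> S" "y \<in> S" "x + y = 0" for x y
    using assms that by (auto simp: positive_semiring_def add_nonneg_eq_0_iff subset_eq)
  then have "Units (additive_monoid S) \<subseteq> {0}"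
    unfolding Units_def additive_monoid_def by fastforce
  moreover have "0 \<in> Units (additive_monoid S)"
    using assms by (auto simp: Units_def additive_monoid_def positive_semiring_def)
  ultimately have "Units (additive_monoid S) = {0}" by blast
  then show ?thesis by (simp add: additive_monoid_def)
qed

text \<open>Two reals that are at least 1 and have product 1 are both 1; the gap between 0 and 1
  thus excludes inverse pairs \<open>x\<close>, \<open>1 / x\<close> other than 1 itself.\<close>

lemma nonunits_multiplicative_monoid:
  assumes "S \<subseteq> {0} \<union> {1..}" "1 \<in> S"
  shows "carrier (multiplicative_monoid S) - Units (multiplicative_monoid S) = {x \<in> S. x > 1}"
proof -
  have "x = 1" if "x * y = 1" "x \<ge> 1" "y \<ge> 1" for x y :: real
    using that mult_left_mono[of 1 y x] by simp
  then show ?thesis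
    using assms by (force simp: multiplicative_monoid_def Units_def)
qed

lemma additive_atoms_eq:
  assumes "positive_semiring S"
  shows "additive_atoms S = {a \<in> S - {0}. \<not> (\<exists>b \<in> S - {0}. \<exists>c \<in> S - {0}. a = b + c)}"
  unfolding atoms_def nonunits_additive_monoid[OF assms] by (simp add: additive_monoid_def)

lemma multiplicative_atoms_eq:
  assumes "S \<subseteq> {0} \<union> {1..}" "1 \<in> S"
  shows "multiplicative_atoms S =
    {a \<in> S. a > 1 \<and> \<not> (\<exists>b \<in> S. \<exists>c \<in> S. b > 1 \<and> c > 1 \<and> a = b * c)}"
  unfolding atoms_def nonunits_multiplicative_monoid[OF assms]
  by (auto simp: multiplicative_monoid_def)

section \<open>Semirings in which 1 is isolated\<close>

lemma bi_BFS_if_isolated_one: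
  assumes S: "positive_semiring S" and lim: "\<not> 1 islimpt ((S - {0}) - {1})"
  shows "bi_BFS S"
proof -
  obtain e where e: "e > 0" and
    isolated: "\<And>x. x \<in> S \<Longrightarrow> x \<noteq> 0 \<Longrightarrow> x \<noteq> 1 \<Longrightarrow> e \<le> dist x 1"
    using lim by (force simp: islimpt_approachable not_less)
  have nonneg: "0 \<le> x" if "x \<in> S" for x
    using S that by (auto simp: positive_semiring_def)
  have pow: "x ^ n \<in> S" if "x \<in> S" for x n
    using S that by (induction n) (auto simp: positive_semiring_def)
  have sub: "S \<subseteq> {0} \<union> {1..}"
  proof (rule ccontr)
    assume "\<not> S \<subseteq> {0} \<union> {1..}"
    then obtain x where x: "x \<in> S" "0 < x" "x < 1"
      using nonneg by force
    \<comment> \<open>Powers of \<open>x\<close> stay in \<open>S\<close> and drop below the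
      isolation radius \<open>e\<close>, so \<open>1 + x ^ n\<close> comes closer to 1 than
      \<open>e\<close> without being 1.\<close>
    obtain n where "x ^ n < e"
      using real_arch_pow_inv[OF e x(3)] by blast
    moreover have "1 + x ^ n \<in> S"
      using S pow[OF x(1)] by (auto simp: positive_semiring_def)
    moreover have "x ^ n > 0" using x by simp
    ultimately show False
      using isolated[of "1 + x ^ n"] unfolding dist_real_def by linarith
  qed
  have one: "1 \<in> S" using S by (simp add: positive_semiring_def)
  have "BFM (additive_monoid S)"
  proof (rule BFM_if_superadditive_length[where f = "\<lambda>x. x"])
    show "comm_monoid_cancel (additive_monoid S)"
      by (rule comm_monoid_cancel_additive_monoid[OF S])
    show "1 \<le> x" if "x \<in> carrier (additive_monoid S) - Units (additive_monoid S)" for x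
      using that sub unfolding nonunits_additive_monoid[OF S] by auto
  qed (use nonneg in \<open>auto simp: additive_monoid_def\<close>)
  moreover have "BFM (multiplicative_monoid S)"
  \<comment> \<open>The base is chosen so that the smallest value \<open>1 + e\<close> allowed for a
    non-unit has logarithm 1. Superadditivity holds with equality.\<close>
  proof (rule BFM_if_superadditive_length[where f = "log (1 + e)"])
    show "comm_monoid_cancel (multiplicative_monoid S)"
      by (rule comm_monoid_cancel_multiplicative_monoid[OF S])
    show "1 \<le> log (1 + e) x"
      if "x \<in> carrier (multiplicative_monoid S) - Units (multiplicative_monoid S)" for x
    proof -
      have "x \<in> S" "x > 1"
        using that unfolding nonunits_multiplicative_monoid[OF sub one] by auto
      then have "1 + e \<le> x"
        using isolated[of x] by (simp add: dist_real_def)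
      then show ?thesis using e \<open>x > 1\<close> by simp
    qed
    show "0 \<le> log (1 + e) x" if "x \<in> carrier (multiplicative_monoid S)" for x
      using that sub e by (force simp: multiplicative_monoid_def)
    show "log (1 + e) x + log (1 + e) y \<le> log (1 + e) (x \<otimes>\<^bsub>multiplicative_monoid S\<^esub> y)"
      if "x \<in> carrier (multiplicative_monoid S)" "y \<in> carrier (multiplicative_monoid S)" for x y
    proof -
      have "x > 0" "y > 0"
        using that nonneg by (force simp: multiplicative_monoid_def)+
      then show ?thesis using e by (simp add: multiplicative_monoid_def log_mult)
    qed
  qed
  ultimately show ?thesis
    using S by (simp add: bi_BFS_def)
qed

section \<open>Explicit form of the ray semiring\<close>

lemma of_nat_in_positive_semiring:
  "positive_semiring S \<Longrightarrow> real n \<in> S"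
  by (induction n) (auto simp: positive_semiring_def)

text \<open>If one operand is not a natural number, it lies in the ray. Adding a nonnegative number
  or multiplying by a nonzero element, which is at least 1, keeps it there.\<close>

lemma positive_semiring_Nats_Un_ray:
  assumes "r \<ge> 1"
  shows "positive_semiring (\<nat> \<union> {r..})"
proof -
  have add: "x + y \<in> \<nat> \<union> {r..}" if "x \<in> \<nat> \<union> {r..}" "y \<in> \<nat> \<union> {r..}" for x y :: real
  proof (cases "x \<in> \<nat> \<and> y \<in> \<nat>")
    case False
    moreover have "x \<ge> 0" "y \<ge> 0"
      using that assms Nats_subset_Ints by (auto simp: Nats_def)
    ultimately show ?thesis using that by auto
  qed auto
  have ge1: "x = 0 \<or> x \<ge> 1" if "x \<in> \<nat> \<union> {r..}" for x :: real
    using that assms by (auto simp: Nats_def)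
  have mult: "x * y \<in> \<nat> \<union> {r..}" if "x \<in> \<nat> \<union> {r..}" "y \<in> \<nat> \<union> {r..}" for x y :: real
  proof (cases "x \<in> \<nat> \<and> y \<in> \<nat> \<or> x = 0 \<or> y = 0")
    case False
    then have "x \<ge> 1" "y \<ge> 1" "x \<ge> r \<or> y \<ge> r"
      using that ge1 by auto
    then have "x * y \<ge> r"
      using assms mult_mono[of r x 1 y] mult_mono[of 1 x r y] by auto
    then show ?thesis by simp
  qed auto
  have "\<nat> \<union> {r..} \<subseteq> {0..}"
    using ge1 by fastforce
  then show ?thesis
    unfolding positive_semiring_def using add mult by (intro conjI ballI) simp_all
qed

lemma ray_semiring_eq_Nats_Un_ray:
  assumes "r \<ge> 1"
  shows "ray_semiring r = \<nat> \<union> {r..}"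
proof
  show "ray_semiring r \<subseteq> \<nat> \<union> {r..}"
    by (rule ray_semiring_minimal[OF positive_semiring_Nats_Un_ray[OF assms]]) simp
  have "positive_semiring (ray_semiring r)"
    using assms by (simp add: positive_semiring_ray_semiring)
  then show "\<nat> \<union> {r..} \<subseteq> ray_semiring r"
    using ray_subset_ray_semiring of_nat_in_positive_semiring by (force simp: Nats_def)
qed

text \<open>Multiplication by \<open>r\<close> extends the ray downwards, to the rays starting at
  the powers of \<open>r\<close>; these powers tend to 0.\<close>

lemma ray_semiring_eq_nonneg:
  assumes "0 < r" "r < 1"
  shows "ray_semiring r = {0..}"
proof
  have S: "positive_semiring (ray_semiring r)"
    using assms by (simp add: positive_semiring_ray_semiring)
  then show "ray_semiring r \<subseteq> {0..}"
    by (simp add: positive_semiring_def)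
  \<comment> \<open>The exponent starts at 1 because the base case is the generating ray itself; the
    step writes \<open>x\<close> as \<open>r * (x / r)\<close>.\<close>
  have "x \<in> ray_semiring r" if "r ^ Suc n \<le> x" for x n
    using that
  proof (induction n arbitrary: x)
    case 0
    then show ?case using ray_subset_ray_semiring by force
  next
    case (Suc n)
    then have "r ^ Suc n \<le> x / r"
      using assms by (simp add: field_simps)
    then have "x / r \<in> ray_semiring r"
      by (rule Suc.IH)
    moreover have "r \<in> ray_semiring r"
      using ray_subset_ray_semiring by force
    ultimately have "r * (x / r) \<in> ray_semiring r"
      using S unfolding positive_semiring_def by blast
    then show ?case using assms by simp
  qed
  moreover have "\<exists>n. r ^ Suc n \<le> x" if x: "x > 0" for x
  proof -
    obtain n where "r ^ n < x"
      using real_arch_pow_inv[OF x assms(2)] by blast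
    moreover have "r ^ Suc n \<le> r ^ n"
      using assms by (intro power_decreasing) auto
    ultimately show ?thesis by (meson less_imp_le order_trans)
  qed
  moreover have "0 \<in> ray_semiring r"
    using S by (simp add: positive_semiring_def)
  ultimately show "{0..} \<subseteq> ray_semiring r"
    by (metis atLeast_iff order_le_less subsetI)
qed

section \<open>Which ray semirings are bi-BFS\<close>

lemma bi_BFS_ray_semiring:
  assumes "r > 1"
  shows "bi_BFS (ray_semiring r)"
proof (rule bi_BFS_if_isolated_one)
  show "positive_semiring (ray_semiring r)"
    using assms by (simp add: positive_semiring_ray_semiring)
  \<comment> \<open>Points of the ray are at distance at least \<open>r - 1\<close> from 1, the
    other natural numbers at distance at least 1.\<close>
  have "min (r - 1) 1 \<le> dist x 1" if "x \<in> ray_semiring r" "x \<noteq> 1" for x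
  proof -
    have "x \<ge> r \<or> (\<exists>n. x = real n)"
      using that assms by (auto simp: ray_semiring_eq_Nats_Un_ray Nats_def)
    then show ?thesis
    proof
      assume "x \<ge> r"
      then show ?thesis using assms by (simp add: dist_real_def)
    next
      assume "\<exists>n. x = real n"
      then obtain n where "x = real n" by blast
      moreover have "n = 0 \<or> n \<ge> 2" using \<open>x = real n\<close> that(2) by (cases n) auto
      ultimately show ?thesis by (auto simp: dist_real_def)
    qed
  qed
  moreover have "min (r - 1) 1 > 0" using assms by simp
  ultimately show "\<not> 1 islimpt ((ray_semiring r - {0}) - {1})"
    unfolding islimpt_approachable by (meson DiffD1 leD)
qed

lemma not_bi_BFS_ray_semiring:
  assumes "0 < r" "r \<le> 1"
  shows "\<not> bi_BFS (ray_semiring r)"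
proof (cases "r = 1")
  case True
  have "\<nat> \<union> {1..} = {0} \<union> {1::real..}"
    by (auto simp: Nats_def)
  then have S: "ray_semiring r = {0} \<union> {1..}"
    using True by (simp add: ray_semiring_eq_Nats_Un_ray)
  have "\<exists>b \<in> {0} \<union> {1..}. \<exists>c \<in> {0} \<union> {1..}. b > 1 \<and> c > 1 \<and> a = b * c" if "a > 1" for a :: real
    using that by (intro bexI[of _ "sqrt a"]) auto
  then have "multiplicative_atoms (ray_semiring r) = {}"
    unfolding S by (subst multiplicative_atoms_eq) (auto simp del: bex_simps)
  \<comment> \<open>Absence of atoms contradicts atomicity only if a non-unit exists; 2 is
    one.\<close>
  moreover have "2 \<in> carrier (multiplicative_monoid (ray_semiring r)) -
      Units (multiplicative_monoid (ray_semiring r))"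
    unfolding S by (subst nonunits_multiplicative_monoid) auto
  ultimately show ?thesis
    by (simp add: bi_BFS_def not_BFM_if_no_atoms)
next
  case False
  have S: "positive_semiring (ray_semiring r)" and eq: "ray_semiring r = {0..}"
    using assms False positive_semiring_ray_semiring[of r] ray_semiring_eq_nonneg[of r] by simp_all
  have "\<exists>b \<in> {0..} - {0}. \<exists>c \<in> {0..} - {0}. a = b + c" if "a \<in> {0..} - {0}" for a :: real
    using that by (intro bexI[of _ "a / 2"]) auto
  then have "additive_atoms (ray_semiring r) = {}"
    unfolding additive_atoms_eq[OF S] unfolding eq by blast
  moreover have "1 \<in> carrier (additive_monoid (ray_semiring r)) -
      Units (additive_monoid (ray_semiring r))"
    unfolding nonunits_additive_monoid[OF S] by (simp add: eq)
  ultimately show ?thesis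
    by (simp add: bi_BFS_def not_BFM_if_no_atoms)
qed

section \<open>Atoms of the ray semiring\<close>

text \<open>Natural numbers above 1 and reals from \<open>r + 1\<close> on split off a summand 1.
  Conversely, a decomposable element of the right-hand side would be a sum of two natural numbers
  lying in \<open>{r..<r + 1}\<close>, where the ceiling of \<open>r\<close> is the only
  integer.\<close>

lemma additive_atoms_ray_semiring:
  assumes "r > 1"
  shows "additive_atoms (ray_semiring r) = ({1} \<union> {r..<r + 1}) - {real_of_int \<lceil>r\<rceil>}"
    (is "_ = ?A")
proof -
  let ?S = "ray_semiring r"
  have S: "positive_semiring ?S" and eq: "?S = \<nat> \<union> {r..}"
    using assms positive_semiring_ray_semiring[of r] ray_semiring_eq_Nats_Un_ray[of r] by simp_all
  have ge1: "x \<ge> 1" if "x \<in> ?S - {0}" for x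
    using that assms by (auto simp: eq Nats_def)
  have atom: "x \<in> ?A" if x: "x \<in> ?S - {0}"
    and irr: "\<And>b c. b \<in> ?S - {0} \<Longrightarrow> c \<in> ?S - {0} \<Longrightarrow> x \<noteq> b + c"
    for x
  proof -
    \<comment> \<open>Irreducibility is used only against the summand 1; this yields both the bound
      \<open>x < r + 1\<close> and the exclusion of natural numbers other than 1.\<close>
    have pred: "x - 1 \<notin> ?S - {0}"
      using irr[of 1 "x - 1"] S by (auto simp: positive_semiring_def)
    have nat: "x = 1" if "x \<in> \<nat>"
    proof -
      obtain n where n: "x = real n" using \<open>x \<in> \<nat>\<close> by (auto simp: Nats_def)
      then have "x - 1 = real (n - 1)" using ge1[OF x] by (simp add: of_nat_diff)
      then have "x - 1 \<in> ?S" using S of_nat_in_positive_semiring by metis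
      then show ?thesis using pred by simp
    qed
    have "x \<noteq> real_of_int \<lceil>r\<rceil>"
    proof
      assume *: "x = real_of_int \<lceil>r\<rceil>"
      then have "x = real (nat \<lceil>r\<rceil>)" using assms by simp
      then have "x = 1" using nat by (metis of_nat_in_Nats)
      then show False using * assms by linarith
    qed
    moreover have "x < r + 1"
      using pred assms by (auto simp: eq)
    ultimately show ?thesis
      using nat x by (auto simp: eq)
  qed
  have nonzero: "x \<in> ?S - {0}" if "x \<in> ?A" for x
    using that assms by (auto simp: eq)
  have irreducible: "x \<noteq> b + c" if x: "x \<in> ?A" and bc: "b \<in> ?S - {0}" "c \<in> ?S - {0}" for x b c
  proof
    assume sum: "x = b + c"
    then have "x \<noteq> 1" "x < r + 1" "r \<le> x"
      using x ge1[OF bc(1)] ge1[OF bc(2)] by auto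
    \<comment> \<open>Each summand is at least 1, so the other one is less than
      \<open>r + 1 - 1\<close>; below \<open>r\<close> only natural numbers are left.\<close>
    then have "b < r" "c < r"
      using sum ge1[OF bc(1)] ge1[OF bc(2)] by linarith+
    then obtain m n where "b = real m" "c = real n"
      using bc by (auto simp: eq Nats_def)
    then have int: "x = real_of_int (int (m + n))" using sum by simp
    have "\<lceil>r\<rceil> = int (m + n)"
      by (rule ceiling_unique) (use \<open>x < r + 1\<close> \<open>r \<le> x\<close> int in linarith)+
    then show False using x int by simp
  qed
  show ?thesis
    unfolding additive_atoms_eq[OF S]
  proof (intro equalityI subsetI)
    fix x assume "x \<in> {a \<in> ?S - {0}. \<not> (\<exists>b \<in> ?S - {0}. \<exists>c \<in> ?S - {0}. a = b + c)}"
    then show "x \<in> ?A" by (intro atom) blast+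
  next
    fix x assume x: "x \<in> ?A"
    show "x \<in> {a \<in> ?S - {0}. \<not> (\<exists>b \<in> ?S - {0}. \<exists>c \<in> ?S - {0}. a = b + c)}"
      using nonzero[OF x] irreducible[OF x] by blast
  qed
qed

text \<open>From \<open>r\<^sup>2\<close> on one can split off the factor \<open>r\<close>, and
  below \<open>r\<close> all elements are natural numbers, so irreducible ones are prime.
  Conversely, if a product is less than \<open>r\<^sup>2\<close>, one factor is below
  \<open>r\<close>, hence a natural number with a prime divisor, and the product lies in the removed
  set.\<close>

lemma multiplicative_atoms_ray_semiring:
  assumes "r > 1"
  shows "multiplicative_atoms (ray_semiring r) =
    ({p \<in> real_primes. p < r\<^sup>2} \<union> {r..<r\<^sup>2})
      - {p * s | p s. p \<in> real_primes \<and> s \<in> ray_semiring r \<and> s > 1}" (is "_ = ?A")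
proof -
  let ?S = "ray_semiring r"
  have S: "positive_semiring ?S" and eq: "?S = \<nat> \<union> {r..}"
    using assms positive_semiring_ray_semiring[of r] ray_semiring_eq_Nats_Un_ray[of r] by simp_all
  have sub: "?S \<subseteq> {0} \<union> {1..}" and one: "1 \<in> ?S"
    using assms by (auto simp: eq Nats_def)
  have primes: "p \<in> ?S" "p > 1" if "p \<in> real_primes" for p
    using that of_nat_in_positive_semiring[OF S] prime_gt_1_nat by (auto simp: real_primes_def)
  \<comment> \<open>The cofactor \<open>m\<close> may be 1: this is the case of a prime
    \<open>x\<close>, and \<open>m \<ge> 1\<close> suffices to keep \<open>real m * c\<close> above
    1 later.\<close>
  have nat_split: "\<exists>p m. p \<in> real_primes \<and> x = p * real m \<and> m \<ge> 1"
    if "x \<in> \<nat>" "x > 1" for x :: real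
  proof -
    obtain n where n: "x = real n" "n > 1" using \<open>x \<in> \<nat>\<close> \<open>x > 1\<close> by (auto simp: Nats_def)
    then obtain p m where "prime p" "n = p * m"
      using prime_factor_nat[of n] by (auto simp: dvd_def)
    then show ?thesis
      using n by (intro exI[of _ "real p"] exI[of _ m]) (auto simp: real_primes_def intro!: Suc_leI gr0I)
  qed
  have atom: "x \<in> ?A" if x: "x \<in> ?S" "x > 1"
    and irr: "\<And>b c. b \<in> ?S \<Longrightarrow> c \<in> ?S \<Longrightarrow> b > 1 \<Longrightarrow> c > 1 \<Longrightarrow> x \<noteq> b * c" for x
  proof -
    have "x < r\<^sup>2"
    proof (rule ccontr)
      assume "\<not> x < r\<^sup>2"
      \<comment> \<open>The quotient lies in the ray, so \<open>x = r * (x / r)\<close> is a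
        forbidden factorization.\<close>
      then have "r \<le> x / r" using assms by (simp add: field_simps power2_eq_square)
      moreover from this have "1 < x / r" using assms by linarith
      ultimately show False using irr[of r "x / r"] assms by (simp add: eq del: less_divide_eq_1_pos)
    qed
    moreover have "x \<in> real_primes" if "x < r"
    proof -
      have "x \<in> \<nat>" using that x by (auto simp: eq)
      then obtain p m where p: "p \<in> real_primes" "x = p * real m" "m \<ge> 1"
        using nat_split x(2) by blast
      \<comment> \<open>Both \<open>p\<close> and \<open>m\<close> lie in the semiring, so
        \<open>m > 1\<close> would give a proper factorization of \<open>x\<close>.\<close>
      then have "\<not> real m > 1"
        using irr[of p "real m"] primes[of p] of_nat_in_positive_semiring[OF S] by blast
      then have "m = 1" using p(3) by simp
      then show ?thesis using p by simp
    qed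
    ultimately show ?thesis
      using irr primes by fastforce
  qed
  have gt1: "x \<in> ?S \<and> x > 1" if "x \<in> ?A" for x
    using that assms primes by (auto simp: eq)
  have irreducible: "x \<noteq> b * c"
    if x: "x \<in> ?A" and bc: "b \<in> ?S" "c \<in> ?S" "b > 1" "c > 1" for x b c
  proof
    assume prod: "x = b * c"
    \<comment> \<open>The factors are quantified afresh so that the argument applies to whichever of
      the two is below \<open>r\<close>. The cofactor of the prime \<open>p\<close> in
      \<open>b\<close> is moved over to \<open>c\<close>.\<close>
    have reducible: False if "b < r" "b \<in> ?S" "c \<in> ?S" "b > 1" "c > 1" "x = b * c" for b c
    proof -
      have "b \<in> \<nat>" using that by (auto simp: eq)
      then obtain p m where p: "p \<in> real_primes" "b = p * real m" "m \<ge> 1"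
        using nat_split \<open>b > 1\<close> by blast
      have "real m * c \<in> ?S"
        using S \<open>c \<in> ?S\<close> of_nat_in_positive_semiring[OF S, of m] by (simp add: positive_semiring_def)
      moreover have "real m * c > 1"
        using p(3) \<open>c > 1\<close> by (intro less_le_trans[OF \<open>c > 1\<close>]) simp
      moreover have "x = p * (real m * c)" using that p by simp
      ultimately show False using x p(1) by blast
    qed
    have "x < r\<^sup>2" using x by auto
    then have "b < r \<or> c < r"
      using prod mult_mono[of r b r c] assms bc by (force simp: power2_eq_square)
    then show False
      using reducible bc prod by (metis mult.commute)
  qed
  show ?thesis
    unfolding multiplicative_atoms_eq[OF sub one]
  proof (intro equalityI subsetI)
    fix x assume "x \<in> {a \<in> ?S. a > 1 \<and> \<not> (\<exists>b \<in> ?S. \<exists>c \<in> ?S. b > 1 \<and> c > 1 \<and> a = b * c)}"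
    then show "x \<in> ?A" by (intro atom) blast+
  next
    fix x assume x: "x \<in> ?A"
    show "x \<in> {a \<in> ?S. a > 1 \<and> \<not> (\<exists>b \<in> ?S. \<exists>c \<in> ?S. b > 1 \<and> c > 1 \<and> a = b * c)}"
      using gt1[OF x] irreducible[OF x] by blast
  qed
qed

theorem theorem5p1:
  "(\<forall>S. positive_semiring S \<longrightarrow> \<not> (1 islimpt ((S - {0}) - {1})) \<longrightarrow> bi_BFS S) \<and>
   (\<forall>r::real. r > 0 \<longrightarrow>
      (bi_BFS (ray_semiring r) \<longleftrightarrow> r > 1) \<and>
      (r > 1 \<longrightarrow>
         additive_atoms (ray_semiring r) = ({1} \<union> {r..<r + 1}) - {real_of_int \<lceil>r\<rceil>} \<and>
         multiplicative_atoms (ray_semiring r) =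
           ({p \<in> real_primes. p < r\<^sup>2} \<union> {r..<r\<^sup>2})
             - {p * s | p s. p \<in> real_primes \<and> s \<in> ray_semiring r \<and> s > 1}))"
  by (intro conjI allI impI iffI bi_BFS_if_isolated_one bi_BFS_ray_semiring
      additive_atoms_ray_semiring multiplicative_atoms_ray_semiring)
    (auto intro: ccontr dest: not_bi_BFS_ray_semiring)

end
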